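(* For every positive integer $n$, the sequence $(JL_{n,k})_{k \ge 0}$ is log-concave, i.e. $JL_{n,k}^2 \ge JL_{n,k-1}JL_{n,k+1}$ for all $1 \le k < \lfloor n/2 \rfloor$.
   Context: For integers $n \ge 1$ and $k \ge 0$, $JL_{n,k} = \sum_{i=k}^{\lfloor n/2 \rfloor} \frac{n}{n-i} \binom{n-i}{i} \binom{i}{k}$, where an empty sum equals $0$. *)

theory Defs
  imports Complex_Main
begin

(* Meant for n >= 1: then i <= n div 2 gives i < n, so the denominator is positive
   and the natural-number subtraction n - i does not truncate. *)
definition JL :: "nat \<Rightarrow> nat \<Rightarrow> real" where
  "JL n k = (\<Sum>i = k..n div 2.
     real n / (real n - real i) * real ((n - i) choose i) * real (i choose k))"

end

theory Submission
  imports Defs "HOL-Computational_Algebra.Polynomial"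
begin

text \<open>
  The generating polynomial of the sequence is the Lucas polynomial evaluated at \<open>1 + x\<close>.
  By the recurrence \<open>L\<^sub>n\<^sub>+\<^sub>2(t) = L\<^sub>n\<^sub>+\<^sub>1(t) + t L\<^sub>n(t)\<close>, its value at
  \<open>t = -1 / (4 cos\<^sup>2 \<theta>)\<close> is \<open>2 cos (n\<theta>) / (2 cos \<theta>)\<^sup>n\<close>, so it has as many distinct negative
  roots as its degree allows. Hence the generating polynomial is, up to a scalar, a product of factors
  \<open>x + r\<close> with \<open>r \<ge> 0\<close>, and multiplication by such a factor preserves log-concavity.
\<close>

section \<open>Log-concavity under multiplication by linear factors\<close>

text \<open>Comparing all pairs \<open>i \<le> j\<close>, rather than only \<open>i = j\<close>, excludes internal zeros; this is
  what makes the property stable under multiplication by \<open>x + r\<close>.\<close>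

definition log_concave_poly :: "real poly \<Rightarrow> bool" where
  "log_concave_poly p \<longleftrightarrow> (\<forall>k. 0 \<le> coeff p k) \<and>
     (\<forall>i j. i \<le> j \<longrightarrow> coeff p i * coeff p (j + 2) \<le> coeff p (i + 1) * coeff p (j + 1))"

lemma log_concave_poly_1: "log_concave_poly 1"
  by (auto simp: log_concave_poly_def)

text \<open>Both products are expanded in powers of \<open>r\<close> and compared coefficient by
  coefficient. The case \<open>i = 0\<close> stands apart because the constant coefficient of the
  product has no shifted term.\<close>

lemma log_concave_poly_mult_linear:
  assumes "log_concave_poly p" and "r \<ge> 0"
  shows "log_concave_poly ([:r, 1:] * p)"
proof -
  define f where "f = coeff p"
  have pos: "0 \<le> f k" for k
    using assms by (simp add: log_concave_poly_def f_def)
  have lc: "f i * f (Suc (Suc j)) \<le> f (Suc i) * f (Suc j)" if "i \<le> j" for i j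
    using assms that by (simp add: log_concave_poly_def f_def)
  define g where "g = coeff ([:r, 1:] * p)"
  have g0: "g 0 = r * f 0" and gS: "g (Suc k) = r * f (Suc k) + f k" for k
    by (simp_all add: g_def f_def coeff_pCons)
  have "g i * g (Suc (Suc j)) \<le> g (Suc i) * g (Suc j)" if ij: "i \<le> j" for i j
  proof (cases i)
    case 0
    have "r * r * (f 0 * f (Suc (Suc j))) \<le> r * r * (f 1 * f (Suc j))"
      using lc[of 0 j] by (intro mult_left_mono) auto
    moreover have "0 \<le> r * (f 1 * f j)" "0 \<le> f 0 * f j"
      using pos assms(2) by simp_all
    ultimately show ?thesis
      by (simp add: 0 g0 gS algebra_simps)
  next
    case (Suc l)
    then obtain m where j: "j = Suc m" and lm: "l \<le> m"
      using ij by (cases j) auto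
    have 1: "r * r * (f (Suc l) * f (Suc (Suc (Suc m)))) \<le> r * r * (f (Suc (Suc l)) * f (Suc (Suc m)))"
      using lc[of "Suc l" "Suc m"] lm by (intro mult_left_mono) auto
    have 2: "f l * f (Suc (Suc m)) \<le> f (Suc l) * f (Suc m)"
      using lc lm by simp
    \<comment> \<open>In the coefficient of \<open>r\<close> the product of \<open>f (l + 1)\<close>
      and \<open>f (m + 2)\<close> occurs on both sides and cancels. The remaining comparison moves
      the indices \<open>l\<close> and \<open>m + 3\<close> together in two steps. If
      \<open>l = m\<close>, the second step is commutativity; otherwise
      \<open>l + 1 \<le> m\<close>, as \<open>lc\<close> demands.\<close>
    have "f l * f (Suc (Suc (Suc m))) \<le> f (Suc l) * f (Suc (Suc m))"
      using lc[of l "Suc m"] lm by simp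
    also have "\<dots> \<le> f (Suc (Suc l)) * f (Suc m)"
      using lc[of "Suc l" m] lm by (cases "l = m") (auto simp: mult.commute)
    finally have "r * (f l * f (Suc (Suc (Suc m)))) \<le> r * (f (Suc (Suc l)) * f (Suc m))"
      using assms(2) by (intro mult_left_mono) auto
    with 1 2 show ?thesis
      by (simp add: Suc j gS algebra_simps)
  qed
  moreover have "0 \<le> g k" for k
    using pos assms(2) by (cases k) (simp_all add: g0 gS)
  ultimately show ?thesis
    by (simp add: log_concave_poly_def g_def)
qed

lemma log_concave_poly_prod_linear:
  assumes "finite S" and "\<And>x. x \<in> S \<Longrightarrow> x \<le> 0"
  shows "log_concave_poly (\<Prod>x\<in>S. [:- x, 1:])"
  using assms
  by (induction S rule: finite_induct)
     (simp_all add: log_concave_poly_1 log_concave_poly_mult_linear del: mult_pCons_left)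

section \<open>Polynomials with enough nonpositive roots\<close>

text \<open>The product is monic of degree \<open>card S\<close>, so subtracting the stated multiple
  kills the coefficient at \<open>card S\<close>. The difference has \<open>card S\<close> roots but
  smaller degree, hence vanishes. An upper bound on the degree of \<open>p\<close> thus
  suffices.\<close>

lemma poly_eq_smult_prod_roots:
  fixes p :: "'a::idom poly"
  assumes "finite S" and "degree p \<le> card S" and "\<And>x. x \<in> S \<Longrightarrow> poly p x = 0"
  shows "p = smult (coeff p (card S)) (\<Prod>x\<in>S. [:- x, 1:])"
proof -
  define q where "q = (\<Prod>x\<in>S. [:- x, 1:])"
  have deg_q: "degree q = card S"
    using assms(1) by (simp add: q_def degree_prod_eq_sum_degree)
  have lc_q: "lead_coeff q = 1"
    unfolding q_def lead_coeff_prod by simp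
  define d where "d = p - smult (coeff p (card S)) q"
  have "poly d x = 0" if "x \<in> S" for x
    using that assms by (auto simp: d_def q_def poly_prod)
  moreover have "d = 0 \<or> degree d < card S"
  proof -
    have "degree d \<le> card S"
      using assms(2) deg_q by (auto simp: d_def intro: degree_diff_le order_trans[OF degree_smult_le])
    moreover have "coeff d (card S) = 0"
      using lc_q deg_q by (simp add: d_def)
    ultimately show ?thesis
      by (metis eq_zero_or_degree_less)
  qed
  ultimately have "d = 0"
  proof -
    assume roots: "\<And>x. x \<in> S \<Longrightarrow> poly d x = 0" and deg: "d = 0 \<or> degree d < card S"
    have "card S \<le> degree d" if "d \<noteq> 0"
      using card_mono[OF poly_roots_finite[OF that], of S] card_poly_roots_bound[OF that] roots
      by (auto intro: order_trans)
    with deg show "d = 0"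
      by linarith
  qed
  then show ?thesis
    by (simp add: d_def q_def)
qed

lemma coeff_log_concave_if_nonpos_roots:
  fixes p :: "real poly"
  assumes "finite S" and "degree p \<le> card S"
    and "\<And>x. x \<in> S \<Longrightarrow> poly p x = 0" and "\<And>x. x \<in> S \<Longrightarrow> x \<le> 0"
  shows "coeff p k * coeff p (k + 2) \<le> (coeff p (k + 1))\<^sup>2"
proof -
  define c where "c = coeff p (card S)"
  define q where "q = (\<Prod>x\<in>S. [:- x, 1:])"
  have p: "p = smult c q"
    unfolding c_def q_def by (rule poly_eq_smult_prod_roots) (use assms in auto)
  have "coeff q k * coeff q (k + 2) \<le> (coeff q (k + 1))\<^sup>2"
    using log_concave_poly_prod_linear[OF assms(1,4)]
    by (simp add: log_concave_poly_def q_def power2_eq_square)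
  \<comment> \<open>Both sides of the inequality are quadratic in the coefficients, so the sign of
    \<open>c\<close> does not matter.\<close>
  then have "c\<^sup>2 * (coeff q k * coeff q (k + 2)) \<le> c\<^sup>2 * (coeff q (k + 1))\<^sup>2"
    by (intro mult_left_mono) auto
  then show ?thesis
    by (simp add: p power2_eq_square algebra_simps)
qed

section \<open>Lucas polynomials\<close>

definition lucas_coeff :: "nat \<Rightarrow> nat \<Rightarrow> real" where
  "lucas_coeff n i = real n / (real n - real i) * real ((n - i) choose i)"

lemma lucas_coeff_0_right: "n \<ge> 1 \<Longrightarrow> lucas_coeff n 0 = 1"
  by (simp add: lucas_coeff_def)

text \<open>Here \<open>n - i < i\<close>, even when the subtraction truncates, so the binomial is
  0.\<close>

lemma lucas_coeff_eq_0: "n \<ge> 1 \<Longrightarrow> n div 2 < i \<Longrightarrow> lucas_coeff n i = 0"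
  by (auto simp: lucas_coeff_def binomial_eq_0)

text \<open>For \<open>i \<ge> n\<close> all three coefficients vanish. Otherwise, with
  \<open>m = n - i > 0\<close>, Pascal's rule writes everything in \<open>A\<close> and
  \<open>B\<close>.\<close>

lemma lucas_coeff_rec:
  assumes "n \<ge> 1"
  shows "lucas_coeff (n + 2) (Suc i) = lucas_coeff (n + 1) (Suc i) + lucas_coeff n i"
proof (cases "i < n")
  case False
  with assms show ?thesis
    by (simp add: lucas_coeff_eq_0)
next
  case True
  then obtain m where n: "n = i + m" and m: "m > 0"
    using less_imp_add_positive by blast
  define A B where "A = real (m choose i)" and "B = real (m choose Suc i)"
  \<comment> \<open>Absorption expresses \<open>B\<close> through \<open>A\<close>, which reduces
    the claim to an identity of rational functions in \<open>m\<close> and \<open>i\<close>.\<close>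
  have "Suc i * (m choose Suc i) = (m - i) * (m choose i)"
    by (simp only: binomial_absorption binomial_absorb_comp)
  then have "real (Suc i * (m choose Suc i)) = real ((m - i) * (m choose i))"
    by (rule arg_cong)
  then have "(real i + 1) * B = (real m - real i) * A"
    by (cases "i \<le> m") (simp_all add: A_def B_def binomial_eq_0 algebra_simps)
  then have B: "B = (real m - real i) * A / (real i + 1)"
    by (simp add: field_simps)
  have "real m > 0" using m by simp
  have "lucas_coeff (n + 2) (Suc i) = (real m + real i + 2) / (real m + 1) * (A + B)"
    by (simp add: lucas_coeff_def n A_def B_def algebra_simps)
  also have "\<dots> = (real m + real i + 1) / real m * B + (real m + real i) / real m * A"
  proof -
    have "A + B = (real m + 1) * A / (real i + 1)"
      unfolding B by (simp add: divide_simps) (simp add: algebra_simps)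
    then have "(real m + real i + 2) / (real m + 1) * (A + B) = (real m + real i + 2) * A / (real i + 1)"
      by simp
    also have "\<dots> = (real m + real i + 1) / real m * B + (real m + real i) / real m * A"
      using \<open>real m > 0\<close> unfolding B by (simp add: divide_simps) (simp add: algebra_simps)
    finally show ?thesis .
  qed
  also have "\<dots> = lucas_coeff (n + 1) (Suc i) + lucas_coeff n i"
    by (simp add: lucas_coeff_def n A_def B_def algebra_simps)
  finally show ?thesis .
qed

text \<open>At \<open>n = 0\<close> the coefficient is 0/0 = 0, so \<open>lucas 0\<close> is 0
  instead of the customary 2; the recurrence therefore starts at index 1.\<close>

definition lucas :: "nat \<Rightarrow> real \<Rightarrow> real" where
  "lucas n t = (\<Sum>i\<le>n div 2. lucas_coeff n i * t ^ i)"

text \<open>Padding with zero terms gives Lucas polynomials of different indices a common summation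
  range, so that the recurrence can be checked termwise.\<close>

lemma lucas_eq_sum:
  assumes "n \<ge> 1" and "n div 2 \<le> N"
  shows "lucas n t = (\<Sum>i\<le>N. lucas_coeff n i * t ^ i)"
  unfolding lucas_def
  by (rule sum.mono_neutral_left) (use assms in \<open>auto simp: lucas_coeff_eq_0\<close>)

lemma lucas_1: "lucas (Suc 0) t = 1"
  by (simp add: lucas_def lucas_coeff_def)

lemma lucas_2: "lucas (Suc (Suc 0)) t = 1 + 2 * t"
  by (simp add: lucas_def lucas_coeff_def)

lemma lucas_rec:
  assumes "n \<ge> 1"
  shows "lucas (n + 2) t = lucas (n + 1) t + t * lucas n t"
proof -
  have "lucas (n + 2) t = 1 + (\<Sum>i\<le>n. lucas_coeff (n + 2) (Suc i) * t ^ Suc i)"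
    by (subst lucas_eq_sum[of _ "Suc n"])
       (simp_all add: sum.atMost_Suc_shift lucas_coeff_0_right del: sum.atMost_Suc power_Suc)
  also have "\<dots> = 1 + (\<Sum>i\<le>n. lucas_coeff (n + 1) (Suc i) * t ^ Suc i)
      + (\<Sum>i\<le>n. lucas_coeff n i * t ^ Suc i)"
    unfolding lucas_coeff_rec[OF assms] by (simp add: algebra_simps sum.distrib)
  also have "1 + (\<Sum>i\<le>n. lucas_coeff (n + 1) (Suc i) * t ^ Suc i) = lucas (n + 1) t"
    by (subst lucas_eq_sum[of _ "Suc n"])
       (simp_all add: sum.atMost_Suc_shift lucas_coeff_0_right del: sum.atMost_Suc power_Suc)
  also have "(\<Sum>i\<le>n. lucas_coeff n i * t ^ Suc i) = t * lucas n t"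
    using assms by (subst lucas_eq_sum[of _ n]) (simp_all add: sum_distrib_left mult_ac)
  finally show ?thesis .
qed

text \<open>At this argument \<open>t\<close>, \<open>(2 * cos \<theta>)\<^sup>2 * t = - 1\<close>,
  so after scaling the Lucas recurrence becomes the one for cosines of consecutive multiples of
  \<open>\<theta>\<close>.\<close>

lemma lucas_cos:
  assumes "cos \<theta> \<noteq> 0"
  shows "(2 * cos \<theta>) ^ Suc n * lucas (Suc n) (- 1 / (4 * (cos \<theta>)\<^sup>2)) = 2 * cos (real (Suc n) * \<theta>)"
proof (induction n rule: induct_nat_012)
  case 0
  show ?case by (simp add: lucas_1)
next
  case 1
  show ?case
    using assms cos_double_cos[of \<theta>]
    by (simp add: lucas_2 power2_eq_square algebra_simps)
next
  case (ge2 n)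
  define c t where "c = cos \<theta>" and "t = - 1 / (4 * (cos \<theta>)\<^sup>2)"
  have t: "(2 * c)\<^sup>2 * t = - 1"
    using assms by (simp add: c_def t_def power2_eq_square)
  have "(2 * c) ^ Suc (Suc (Suc n)) * lucas (Suc (Suc (Suc n))) t
      = 2 * c * ((2 * c) ^ Suc (Suc n) * lucas (Suc (Suc n)) t)
        + ((2 * c)\<^sup>2 * t) * ((2 * c) ^ Suc n * lucas (Suc n) t)"
    using lucas_rec[of "Suc n" t] by (simp add: algebra_simps power2_eq_square)
  also have "\<dots> = 2 * (2 * c * cos (real (Suc (Suc n)) * \<theta>) - cos (real (Suc n) * \<theta>))"
    unfolding t ge2[folded c_def t_def] by simp
  also have "2 * c * cos (real (Suc (Suc n)) * \<theta>) - cos (real (Suc n) * \<theta>)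
      = cos (real (Suc (Suc (Suc n))) * \<theta>)"
    using cos_add[of "real (Suc (Suc n)) * \<theta>" \<theta>] cos_diff[of "real (Suc (Suc n)) * \<theta>" \<theta>]
    by (simp add: c_def algebra_simps)
  finally show ?case
    by (simp only: c_def t_def)
qed

section \<open>The generating polynomial and its roots\<close>

lemma coeff_one_plus_X_power: "coeff ([:1, 1:] ^ n :: 'a::comm_semiring_1 poly) k = of_nat (n choose k)"
proof (cases "k \<le> n")
  case True
  then show ?thesis
    by (simp add: coeff_linear_poly_power)
next
  case False
  have "degree ([:1, 1:] ^ n :: 'a poly) \<le> n"
    using degree_power_le[of "[:1, 1:] :: 'a poly" n] by simp
  with False show ?thesis
    by (simp add: coeff_eq_0 binomial_eq_0)
qed

text \<open>Substituting 1 + x into the Lucas polynomial creates the factor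
  \<open>i choose k\<close> in \<open>JL n k\<close>.\<close>

definition JL_poly :: "nat \<Rightarrow> real poly" where
  "JL_poly n = (\<Sum>i\<le>n div 2. smult (lucas_coeff n i) ([:1, 1:] ^ i))"

lemma coeff_JL_poly: "coeff (JL_poly n) k = JL n k"
proof -
  have "coeff (JL_poly n) k = (\<Sum>i\<le>n div 2. lucas_coeff n i * real (i choose k))"
    by (simp add: JL_poly_def coeff_sum coeff_one_plus_X_power)
  also have "\<dots> = JL n k"
    unfolding JL_def lucas_coeff_def[symmetric]
    by (rule sum.mono_neutral_right) (auto simp: binomial_eq_0)
  finally show ?thesis .
qed

lemma poly_JL_poly: "poly (JL_poly n) x = lucas n (1 + x)"
  by (simp add: JL_poly_def lucas_def poly_sum)

lemma degree_JL_poly_le: "degree (JL_poly n) \<le> n div 2"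
proof (rule degree_le, intro allI impI)
  fix k assume "n div 2 < k"
  then show "coeff (JL_poly n) k = 0"
    by (simp add: coeff_JL_poly JL_def)
qed

text \<open>For \<open>j < n div 2\<close> these are the zeros of cos(n \<theta>) strictly between 0
  and \<pi>/2. For odd \<open>n\<close> the bound leaves out \<pi>/2 itself, where the cosine in the
  denominator of \<open>JL_root\<close> would vanish.\<close>

definition JL_angle :: "nat \<Rightarrow> nat \<Rightarrow> real" where
  "JL_angle n j = real (2 * j + 1) * pi / (2 * real n)"

definition JL_root :: "nat \<Rightarrow> nat \<Rightarrow> real" where
  "JL_root n j = - 1 - 1 / (4 * (cos (JL_angle n j))\<^sup>2)"

lemma JL_angle_bounds:
  assumes "j < n div 2"
  shows "0 < JL_angle n j" and "JL_angle n j < pi / 2"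
proof -
  have n: "real n > 0" "real (2 * j + 1) < real n"
    using assms by linarith+
  show "0 < JL_angle n j"
    using n(1) by (simp add: JL_angle_def)
  have "real (2 * j + 1) * pi < real n * pi"
    using n(2) by (intro mult_strict_right_mono) auto
  then show "JL_angle n j < pi / 2"
    using n(1) by (simp add: JL_angle_def field_simps)
qed

lemma cos_JL_angle_pos: "j < n div 2 \<Longrightarrow> cos (JL_angle n j) > 0"
  using JL_angle_bounds[of j n] by (intro cos_gt_zero_pi) auto

lemma poly_JL_poly_root:
  assumes "j < n div 2"
  shows "poly (JL_poly n) (JL_root n j) = 0"
proof -
  obtain m where m: "n = Suc m"
    using assms by (cases n) auto
  let ?\<theta> = "JL_angle n j"
  have "real n * ?\<theta> = real_of_int (2 * int j + 1) * (pi / 2)"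
    using m by (simp add: JL_angle_def field_simps)
  then have "cos (real n * ?\<theta>) = 0"
    unfolding cos_zero_iff_int by (intro exI[of _ "2 * int j + 1"]) auto
  then have "(2 * cos ?\<theta>) ^ n * lucas n (- 1 / (4 * (cos ?\<theta>)\<^sup>2)) = 0"
    using lucas_cos[of ?\<theta> m] cos_JL_angle_pos[OF assms] m by simp
  then show ?thesis
    using cos_JL_angle_pos[OF assms] by (simp add: poly_JL_poly JL_root_def)
qed

text \<open>A root determines the squared cosine, positivity gives the cosine, and cosine is
  injective on [0, \<pi>].\<close>

lemma inj_on_JL_root: "inj_on (JL_root n) {..<n div 2}"
proof (rule inj_onI)
  fix i j assume *: "i \<in> {..<n div 2}" "j \<in> {..<n div 2}" and "JL_root n i = JL_root n j"
  then have "(cos (JL_angle n i))\<^sup>2 = (cos (JL_angle n j))\<^sup>2"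
    by (simp add: JL_root_def)
  then have "cos (JL_angle n i) = cos (JL_angle n j)"
    using cos_JL_angle_pos[of _ n] * by (metis lessThan_iff less_imp_le power2_eq_imp_eq)
  then have "JL_angle n i = JL_angle n j"
  proof (rule cos_inj_pi[rotated -1])
    show "0 \<le> JL_angle n i" "JL_angle n i \<le> pi" "0 \<le> JL_angle n j" "JL_angle n j \<le> pi"
      using JL_angle_bounds[of i n] JL_angle_bounds[of j n] * pi_gt_zero by simp_all
  qed
  then show "i = j"
    using * by (auto simp: JL_angle_def)
qed

theorem theorem2p4:
  fixes n :: nat
  assumes "n \<ge> 1"
  shows "\<forall>k::nat. 1 \<le> k \<and> k < n div 2 \<longrightarrow> (JL n k)\<^sup>2 \<ge> JL n (k - 1) * JL n (k + 1)"
proof (intro allI impI)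
  fix k :: nat assume k: "1 \<le> k \<and> k < n div 2"
  let ?S = "JL_root n ` {..<n div 2}"
  have "card ?S = n div 2"
    by (simp add: card_image inj_on_JL_root)
  moreover have "JL_root n j \<le> 0" for j
  proof -
    have "0 \<le> 1 / (4 * (cos (JL_angle n j))\<^sup>2)"
      by simp
    then show ?thesis
      unfolding JL_root_def by linarith
  qed
  ultimately have "coeff (JL_poly n) l * coeff (JL_poly n) (l + 2) \<le> (coeff (JL_poly n) (l + 1))\<^sup>2" for l
    by (intro coeff_log_concave_if_nonpos_roots[of ?S])
       (auto simp: degree_JL_poly_le poly_JL_poly_root)
  \<comment> \<open>The shift to \<open>k - 1\<close> is exact since
    \<open>k \<ge> 1\<close>.\<close>
  from this[of "k - 1"] k show "(JL n k)\<^sup>2 \<ge> JL n (k - 1) * JL n (k + 1)"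
    by (simp add: coeff_JL_poly)
qed

end
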